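(* Consider the MAS-DALTD with $n$ agents and horizon $T$, and let the initial state $\mathbf{y}(0)=\mathbf{y}_0\in\mathbb{R}^{mn}$ be given. Assume: (A1) the terminal utilities $\Phi_i$ are concave functions, for $i=1,\dots,n$; (A2) the $f_i$ are concave functions, for $i=1,\dots,n$; (A3) the $h_i$ are nonnegative convex functions, for $i=1,\dots,n$, and $h_i(\mathbf{z})<b$ defines a bounded open set of $\mathbf{z}$ in $\mathbb{R}^m$ for $b>0$; (A4) $\sum_{i=1}^n a_i(t)>0$ for all $t=0,\dots,T-1$. Then the dynamic social welfare equilibrium(s) and the dynamic competitive equilibrium(s) coincide, and the following statements hold. (i) If $(\boldsymbol{\lambda}^\ast,\mathbf{U}^\ast,\mathbf{E}^\ast)$ is a dynamic competitive equilibrium, then $(\mathbf{U}^\ast,\mathbf{E}^\ast)$ is a dynamic social welfare equilibrium. (ii) If $(\mathbf{U}^\star,\mathbf{E}^\star)$ is a dynamic social welfare equilibrium, then there exists $\boldsymbol{\lambda}^\ast\in\mathbb{R}^T$ such that $(\boldsymbol{\lambda}^\ast,\mathbf{U}^\star,\mathbf{E}^\star)$ is a dynamic competitive equilibrium.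
   Context: Multi-agent system with dynamic agent load/trading decisions (MAS-DALTD): there are $n$ agents $i=1,\dots,n$. Agent $i$ has state $\mathbf{y}_i(t)\in\mathbb{R}^m$ and control $\mathbf{u}_i(t)\in\mathbb{R}^m$ with $$\mathbf{y}_i(t+1)=\mathbf{A}_i\mathbf{y}_i(t)+\mathbf{B}_i\mathbf{u}_i(t),\quad t=0,\dots,T-1,$$ where $\mathbf{A}_i,\mathbf{B}_i$ are real matrices of proper dimensions and the initial states $\mathbf{y}_i(0)$ are the blocks of the given vector $\mathbf{y}_0\in\mathbb{R}^{mn}$. At time $t\in\{0,\dots,T-1\}$ agent $i$ has (real-valued) utility $f_i(\mathbf{y}_i(t),\mathbf{u}_i(t))$, needs $h_i(\mathbf{u}_i(t))$ units of resource for its control action, produces $a_i(t)$ units of resource, and trades $e_i(t)\in\mathbb{R}$ units over the network. Physically, if $h_i(\mathbf{u}_i(t))<a_i(t)$ agent $i$ can sell, with $0\le e_i(t)\le a_i(t)-h_i(\mathbf{u}_i(t))$, and if $h_i(\mathbf{u}_i(t))\ge a_i(t)$ agent $i$ will buy, with $e_i(t)=a_i(t)-h_i(\mathbf{u}_i(t))\le 0$; in the equilibrium definitions below the constraint imposed is $e_i(t)\le a_i(t)-h_i(\mathbf{u}_i(t))$. The terminal utility of agent $i$ is $\Phi_i(\mathbf{y}_i(T))$. The unit price of traded resource at time $t$ is $\lambda_t\in\mathbb{R}$, and $\boldsymbol{\lambda}=(\lambda_0,\dots,\lambda_{T-1})^\top$. Write $\mathbf{U}_i=(\mathbf{u}_i(t))_{t=0}^{T-1}$,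 $\mathbf{E}_i=(e_i(t))_{t=0}^{T-1}$, and $\mathbf{U}$, $\mathbf{E}$ for the collections of all $\mathbf{U}_i$, $\mathbf{E}_i$, $i=1,\dots,n$. Dynamic competitive equilibrium: a triple $(\boldsymbol{\lambda}^\ast,\mathbf{U}^\ast,\mathbf{E}^\ast)$ with $\boldsymbol{\lambda}^\ast\in\mathbb{R}^T$ such that (a) for every $i$, $(\mathbf{U}_i^\ast,\mathbf{E}_i^\ast)$ maximizes $$\sum_{t=0}^{T-1}\Big(f_i(\mathbf{y}_i(t),\mathbf{u}_i(t))+\lambda_t^\ast e_i(t)\Big)+\Phi_i(\mathbf{y}_i(T))$$ over all $(\mathbf{U}_i,\mathbf{E}_i)$ subject to the dynamics of agent $i$ and $e_i(t)\le a_i(t)-h_i(\mathbf{u}_i(t))$ for $t=0,\dots,T-1$; and (b) $\sum_{i=1}^n e_i^\ast(t)=0$ for $t=0,\dots,T-1$. Dynamic social welfare equilibrium: a pair $(\mathbf{U}^\star,\mathbf{E}^\star)$ that maximizes $$\sum_{i=1}^n\Big(\sum_{t=0}^{T-1}f_i(\mathbf{y}_i(t),\mathbf{u}_i(t))+\Phi_i(\mathbf{y}_i(T))\Big)$$ over all $(\mathbf{U},\mathbf{E})$ subject to the dynamics of all agents, $e_i(t)\le a_i(t)-h_i(\mathbf{u}_i(t))$ for all $i$ and $t=0,\dots,T-1$, and $\sum_{i=1}^n e_i(t)=0$ for $t=0,\dots,T-1$.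
   Formalization: In (A3) the sets h_i(z) < b are also required to be nonempty for every b > 0; otherwise (ii) fails, e.g. n = m = T = 1, Φ = 0, f(y,u) = u, h(u) = u² + 5, a = 5, where the welfare optimum u = e = 0 is supported by no price. *)

theory Defs
  imports "HOL-Analysis.Analysis"
begin

text \<open>
  Agents are indexed by a finite type \<open>'n\<close> and states and controls live in \<open>real ^ 'm\<close>; the
  stacked initial state is \<open>y0 :: real ^ 'm ^ 'n\<close>, with blocks \<open>y0 $ i\<close>. Time-indexed families
  over \<open>0, ..., T - 1\<close> (controls, trades, productions, prices) are functions on \<open>nat\<close>; none of
  the notions below depends on their values at times \<open>t \<ge> T\<close>.
\<close>

primrec state ::
  "real ^ 'm ^ 'm \<Rightarrow> real ^ 'm ^ 'm \<Rightarrow> real ^ 'm \<Rightarrow> (nat \<Rightarrow> real ^ 'm) \<Rightarrow> nat \<Rightarrow> real ^ 'm"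
where
  "state A B x0 u 0 = x0"
| "state A B x0 u (Suc t) = A *v state A B x0 u t + B *v u t"

definition trade_feasible ::
  "nat \<Rightarrow> (real ^ 'm \<Rightarrow> real) \<Rightarrow> (nat \<Rightarrow> real) \<Rightarrow> (nat \<Rightarrow> real ^ 'm) \<Rightarrow> (nat \<Rightarrow> real) \<Rightarrow> bool"
where
  "trade_feasible T h a u e \<longleftrightarrow> (\<forall>t<T. e t \<le> a t - h (u t))"

definition agent_payoff ::
  "nat \<Rightarrow> real ^ 'm ^ 'm \<Rightarrow> real ^ 'm ^ 'm \<Rightarrow> (real ^ 'm \<Rightarrow> real ^ 'm \<Rightarrow> real) \<Rightarrow> (real ^ 'm \<Rightarrow> real) \<Rightarrow>
   real ^ 'm \<Rightarrow> (nat \<Rightarrow> real) \<Rightarrow> (nat \<Rightarrow> real ^ 'm) \<Rightarrow> (nat \<Rightarrow> real) \<Rightarrow> real"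
where
  "agent_payoff T A B f \<Phi> x0 p u e =
     (\<Sum>t<T. f (state A B x0 u t) (u t) + p t * e t) + \<Phi> (state A B x0 u T)"

definition social_welfare ::
  "nat \<Rightarrow> ('n::finite \<Rightarrow> real ^ 'm ^ 'm) \<Rightarrow> ('n \<Rightarrow> real ^ 'm ^ 'm) \<Rightarrow>
   ('n \<Rightarrow> real ^ 'm \<Rightarrow> real ^ 'm \<Rightarrow> real) \<Rightarrow> ('n \<Rightarrow> real ^ 'm \<Rightarrow> real) \<Rightarrow> real ^ 'm ^ 'n \<Rightarrow>
   ('n \<Rightarrow> nat \<Rightarrow> real ^ 'm) \<Rightarrow> real"
where
  "social_welfare T A B f \<Phi> y0 U =
     (\<Sum>i\<in>UNIV. (\<Sum>t<T. f i (state (A i) (B i) (y0 $ i) (U i) t) (U i t))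
                 + \<Phi> i (state (A i) (B i) (y0 $ i) (U i) T))"

definition market_clearing :: "nat \<Rightarrow> ('n::finite \<Rightarrow> nat \<Rightarrow> real) \<Rightarrow> bool" where
  "market_clearing T E \<longleftrightarrow> (\<forall>t<T. (\<Sum>i\<in>UNIV. E i t) = 0)"

definition competitive_equilibrium ::
  "nat \<Rightarrow> ('n::finite \<Rightarrow> real ^ 'm ^ 'm) \<Rightarrow> ('n \<Rightarrow> real ^ 'm ^ 'm) \<Rightarrow>
   ('n \<Rightarrow> real ^ 'm \<Rightarrow> real ^ 'm \<Rightarrow> real) \<Rightarrow> ('n \<Rightarrow> real ^ 'm \<Rightarrow> real) \<Rightarrow>
   ('n \<Rightarrow> real ^ 'm \<Rightarrow> real) \<Rightarrow> ('n \<Rightarrow> nat \<Rightarrow> real) \<Rightarrow> real ^ 'm ^ 'n \<Rightarrow>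
   (nat \<Rightarrow> real) \<Rightarrow> ('n \<Rightarrow> nat \<Rightarrow> real ^ 'm) \<Rightarrow> ('n \<Rightarrow> nat \<Rightarrow> real) \<Rightarrow> bool"
where
  "competitive_equilibrium T A B f \<Phi> h a y0 p U E \<longleftrightarrow>
     (\<forall>i. is_arg_max (\<lambda>(u, e). agent_payoff T (A i) (B i) (f i) (\<Phi> i) (y0 $ i) p u e)
                     (\<lambda>(u, e). trade_feasible T (h i) (a i) u e)
                     (U i, E i)) \<and>
     market_clearing T E"

definition social_welfare_equilibrium ::
  "nat \<Rightarrow> ('n::finite \<Rightarrow> real ^ 'm ^ 'm) \<Rightarrow> ('n \<Rightarrow> real ^ 'm ^ 'm) \<Rightarrow>
   ('n \<Rightarrow> real ^ 'm \<Rightarrow> real ^ 'm \<Rightarrow> real) \<Rightarrow> ('n \<Rightarrow> real ^ 'm \<Rightarrow> real) \<Rightarrow>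
   ('n \<Rightarrow> real ^ 'm \<Rightarrow> real) \<Rightarrow> ('n \<Rightarrow> nat \<Rightarrow> real) \<Rightarrow> real ^ 'm ^ 'n \<Rightarrow>
   ('n \<Rightarrow> nat \<Rightarrow> real ^ 'm) \<Rightarrow> ('n \<Rightarrow> nat \<Rightarrow> real) \<Rightarrow> bool"
where
  "social_welfare_equilibrium T A B f \<Phi> h a y0 U E \<longleftrightarrow>
     is_arg_max (\<lambda>(U', E'). social_welfare T A B f \<Phi> y0 U')
                (\<lambda>(U', E'). (\<forall>i. trade_feasible T (h i) (a i) (U' i) (E' i)) \<and> market_clearing T E')
                (U, E)"

text \<open>
  The sublevel sets are required to be nonempty. If they could be empty for small \<open>b\<close>, the
  Slater condition could fail: with one agent, \<open>T = m = 1\<close>, \<open>\<Phi> = 0\<close>, \<open>f y u = u\<close>,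
  \<open>h u = u^2 + 5\<close> and \<open>a = 5\<close>, the welfare optimum \<open>u = e = 0\<close> is supported by no price.
\<close>

definition bounded_open_sublevels :: "(real ^ 'm \<Rightarrow> real) \<Rightarrow> bool" where
  "bounded_open_sublevels h \<longleftrightarrow>
     (\<forall>b>0. {z. h z < b} \<noteq> {} \<and> bounded {z. h z < b} \<and> open {z. h z < b})"

end

theory Submission
  imports Defs
begin

text \<open>
  Summing the agents' optimality conditions and cancelling the payments by market clearing gives (i).
  For (ii), the trades can be eliminated from the welfare problem: it is the maximization of a
  concave function of the controls under one convex constraint per time step, total demand at most
  total supply, and (A3) with (A4) provides a Slater point. The prices are the Lagrange multipliers
  of these constraints. The Lagrangian is separable over the agents, and complementary slackness
  identifies each agent's part of it with that agent's payoff.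
\<close>

section \<open>Lagrange multipliers for convexlike problems\<close>

text \<open>Where \<open>g x > 0\<close>, the inequality \<open>F x - p * g x \<le> v\<close> bounds
  \<open>p\<close> from below, and where \<open>g x < 0\<close> it bounds \<open>p\<close> from
  above. Mixing two such points shows that no lower bound exceeds an upper one, so the supremum of
  the lower bounds serves as \<open>p\<close>.\<close>

lemma single_lagrange_multiplier:
  fixes F g :: "'a \<Rightarrow> real"
  assumes convexlike: "\<And>x y r s. x \<in> C \<Longrightarrow> y \<in> C \<Longrightarrow> 0 \<le> r \<Longrightarrow> 0 \<le> s \<Longrightarrow> r + s = 1 \<Longrightarrow>
      \<exists>z\<in>C. r * F x + s * F y \<le> F z \<and> g z \<le> r * g x + s * g y"
    and slater: "x0 \<in> C" "g x0 < 0"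
    and bound: "\<And>x. x \<in> C \<Longrightarrow> g x \<le> 0 \<Longrightarrow> F x \<le> v"
  shows "\<exists>p\<ge>0. \<forall>x\<in>C. F x - p * g x \<le> v"
proof -
  \<comment> \<open>The lower bounds on the multiplier; \<open>0\<close> makes \<open>p\<close>
    nonnegative and the set nonempty.\<close>
  let ?R = "insert 0 {(F x - v) / g x | x. x \<in> C \<and> 0 < g x}"
  have upper: "q \<le> (v - F y) / (- g y)" if "q \<in> ?R" "y \<in> C" "g y < 0" for q y
  proof -
    have "F y \<le> v" using bound that by simp
    show ?thesis
    proof (cases "q = 0")
      case True
      with \<open>F y \<le> v\<close> that show ?thesis by (simp add: divide_nonneg_neg divide_nonpos_neg)
    next
      case False
      with that obtain x where x: "q = (F x - v) / g x" "x \<in> C" "0 < g x" by auto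
      let ?d = "g x - g y"
      have d: "0 < ?d" using x that by simp
      \<comment> \<open>With these weights the combination of \<open>g x\<close> and
        \<open>g y\<close> vanishes, so \<open>z\<close> is feasible and
        \<open>F z \<le> v\<close>.\<close>
      obtain z where z: "z \<in> C" "(- g y / ?d) * F x + (g x / ?d) * F y \<le> F z"
          "g z \<le> (- g y / ?d) * g x + (g x / ?d) * g y"
      proof -
        have "0 \<le> - g y / ?d" "0 \<le> g x / ?d" using x \<open>g y < 0\<close> d
          by (simp_all add: divide_le_0_iff)
        moreover have "- g y / ?d + g x / ?d = 1"
          using d by (simp flip: diff_divide_distrib)
        ultimately show ?thesis
          using convexlike[OF \<open>x \<in> C\<close> \<open>y \<in> C\<close>] by (blast intro: that)
      qed
      have "g z \<le> 0" using z(3) by (simp add: algebra_simps)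
      then have "(- g y / ?d) * F x + (g x / ?d) * F y \<le> v" using bound z by fastforce
      then have "(- g y * F x + g x * F y) / ?d \<le> v" by (simp add: diff_divide_distrib)
      then have "- g y * F x + g x * F y \<le> v * ?d" using d by (simp add: pos_divide_le_eq)
      moreover have "F x = v + q * g x" using x by simp
      ultimately have "g x * F y \<le> g x * (v + q * g y)" by (simp add: algebra_simps)
      then have "F y \<le> v + q * g y" using x(3) by (simp only: mult_le_cancel_left_pos)
      then show ?thesis using \<open>g y < 0\<close> by (simp add: field_simps)
    qed
  qed
  have bdd: "bdd_above ?R"
    using upper slater by (intro bdd_aboveI) blast
  define p where "p = Sup ?R"
  have ge: "q \<le> p" if "q \<in> ?R" for q
    unfolding p_def using that bdd by (rule cSup_upper)
  have le: "p \<le> (v - F y) / (- g y)" if "y \<in> C" "g y < 0" for y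
    unfolding p_def using upper that by (intro cSup_least) blast+
  have "F x - p * g x \<le> v" if "x \<in> C" for x
  proof (cases "g x" "0::real" rule: linorder_cases)
    case less
    then show ?thesis using le[OF that less] by (simp add: field_simps)
  next
    case equal
    then show ?thesis using bound that by simp
  next
    case greater
    then have "(F x - v) / g x \<le> p" using that by (intro ge) blast
    then show ?thesis using greater by (simp add: field_simps)
  qed
  moreover have "0 \<le> p" by (rule ge) simp
  ultimately show ?thesis by blast
qed

text \<open>
  Convexity is only required in Fan's convexlike form, so that \<open>C\<close> can be a set of control
  families, whose type carries no vector space structure. The constraints are dualized one at a time.
\<close>

lemma lagrange_multipliers:
  fixes F :: "'a \<Rightarrow> real" and g :: "nat \<Rightarrow> 'a \<Rightarrow> real"
  assumes "\<And>x y r s. x \<in> C \<Longrightarrow> y \<in> C \<Longrightarrow> 0 \<le> r \<Longrightarrow> 0 \<le> s \<Longrightarrow> r + s = 1 \<Longrightarrow>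
      \<exists>z\<in>C. r * F x + s * F y \<le> F z \<and> (\<forall>t<T. g t z \<le> r * g t x + s * g t y)"
    and "x0 \<in> C" "\<And>t. t < T \<Longrightarrow> g t x0 < 0"
    and "\<And>x. x \<in> C \<Longrightarrow> (\<And>t. t < T \<Longrightarrow> g t x \<le> 0) \<Longrightarrow> F x \<le> v"
  shows "\<exists>p. (\<forall>t<T. 0 \<le> p t) \<and> (\<forall>x\<in>C. F x - (\<Sum>t<T. p t * g t x) \<le> v)"
  using assms
proof (induction T arbitrary: F)
  case 0
  then show ?case by auto
next
  case (Suc T)
  note convexlike = Suc.prems(1) and slater = Suc.prems(2,3) and bound = Suc.prems(4)
  \<comment> \<open>The constraint with index \<open>T\<close> is dualized first, over the points
    satisfying the earlier ones; the induction hypothesis then treats the penalized objective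
    \<open>F x - q * g T x\<close> on all of \<open>C\<close>.\<close>
  let ?C = "{x \<in> C. \<forall>t<T. g t x \<le> 0}"
  have "\<exists>q\<ge>0. \<forall>x\<in>?C. F x - q * g T x \<le> v"
  proof (rule single_lagrange_multiplier)
    fix x y and r s :: real
    assume xy: "x \<in> ?C" "y \<in> ?C" and rs: "0 \<le> r" "0 \<le> s" "r + s = 1"
    then obtain z where z: "z \<in> C" "r * F x + s * F y \<le> F z"
        "\<forall>t<Suc T. g t z \<le> r * g t x + s * g t y"
      using convexlike[of x y r s] by auto
    have "g t z \<le> 0" if "t < T" for t
    proof -
      have "g t z \<le> r * g t x + s * g t y" using z(3) that by simp
      also have "\<dots> \<le> 0"
        using xy rs that by (intro add_nonpos_nonpos mult_nonneg_nonpos) auto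
      finally show ?thesis .
    qed
    with z show "\<exists>z\<in>?C. r * F x + s * F y \<le> F z \<and> g T z \<le> r * g T x + s * g T y" by auto
  next
    show "x0 \<in> ?C" using slater by (auto simp: less_imp_le)
    show "g T x0 < 0" using slater by simp
    show "F x \<le> v" if "x \<in> ?C" "g T x \<le> 0" for x
      using that by (intro bound) (auto simp: less_Suc_eq)
  qed
  then obtain q where q: "0 \<le> q" "\<forall>x\<in>?C. F x - q * g T x \<le> v" by blast
  have "\<exists>p. (\<forall>t<T. 0 \<le> p t) \<and> (\<forall>x\<in>C. (F x - q * g T x) - (\<Sum>t<T. p t * g t x) \<le> v)"
  proof (rule Suc.IH)
    fix x y and r s :: real
    assume "x \<in> C" "y \<in> C" "0 \<le> r" "0 \<le> s" "r + s = 1"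
    then obtain z where z: "z \<in> C" "r * F x + s * F y \<le> F z"
        "\<forall>t<Suc T. g t z \<le> r * g t x + s * g t y"
      using convexlike by blast
    \<comment> \<open>As \<open>q \<ge> 0\<close>, the penalized objective still satisfies the
      convexlike condition.\<close>
    have "q * g T z \<le> q * (r * g T x + s * g T y)"
      using z(3) q(1) by (intro mult_left_mono) auto
    with z show "\<exists>z\<in>C. r * (F x - q * g T x) + s * (F y - q * g T y) \<le> F z - q * g T z \<and>
        (\<forall>t<T. g t z \<le> r * g t x + s * g t y)"
      by (intro bexI[of _ z]) (auto simp: algebra_simps)
  qed (use slater q(2) in auto)
  then obtain p where p: "\<forall>t<T. 0 \<le> p t"
      "\<forall>x\<in>C. (F x - q * g T x) - (\<Sum>t<T. p t * g t x) \<le> v" by blast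
  then show ?case
    using q(1) by (intro exI[of _ "p(T := q)"]) (auto simp: less_Suc_eq algebra_simps)
qed

section \<open>Concavity of utilities in the controls\<close>

text \<open>Because of the fixed initial state, the trajectory is affine rather than linear in the
  controls; hence the condition \<open>r + s = 1\<close>.\<close>

lemma state_convex_combination:
  assumes "r + s = 1"
  shows "state A B x0 (\<lambda>t. r *\<^sub>R u t + s *\<^sub>R w t) t = r *\<^sub>R state A B x0 u t + s *\<^sub>R state A B x0 w t"
proof (induction t)
  case 0
  then show ?case using assms by (simp flip: scaleR_add_left)
next
  case (Suc t)
  then show ?case
    by (simp add: matrix_vector_right_distrib matrix_vector_mult_scaleR scaleR_add_right)
qed

lemma concave_on_combination:
  assumes "concave_on UNIV f" "0 \<le> r" "0 \<le> s" "r + s = 1"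
  shows "r * f x + s * f y \<le> f (r *\<^sub>R x + s *\<^sub>R y)"
  using assms by (auto simp: concave_on_iff)

text \<open>At zero prices \<open>agent_payoff\<close> is pure utility and \<open>e\<close> drops
  out. States and controls mix with the same weights, so joint concavity of \<open>f\<close> applies
  at each time.\<close>

lemma agent_utility_concave:
  assumes "concave_on UNIV \<Phi>" "concave_on UNIV (\<lambda>(y, u). f y u)" "0 \<le> r" "0 \<le> s" "r + s = 1"
  shows "r * agent_payoff T A B f \<Phi> x0 (\<lambda>_. 0) u e + s * agent_payoff T A B f \<Phi> x0 (\<lambda>_. 0) w e
    \<le> agent_payoff T A B f \<Phi> x0 (\<lambda>_. 0) (\<lambda>t. r *\<^sub>R u t + s *\<^sub>R w t) e"
proof -
  let ?c = "\<lambda>t. r *\<^sub>R u t + s *\<^sub>R w t"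
  have "(\<Sum>t<T. r * f (state A B x0 u t) (u t) + s * f (state A B x0 w t) (w t))
      \<le> (\<Sum>t<T. f (state A B x0 ?c t) (?c t))"
  proof (rule sum_mono)
    fix t
    show "r * f (state A B x0 u t) (u t) + s * f (state A B x0 w t) (w t)
        \<le> f (state A B x0 ?c t) (?c t)"
      using concave_on_combination[OF assms(2-5), of "(state A B x0 u t, u t)" "(state A B x0 w t, w t)"]
      by (simp add: state_convex_combination[OF assms(5)])
  qed
  moreover have "r * \<Phi> (state A B x0 u T) + s * \<Phi> (state A B x0 w T) \<le> \<Phi> (state A B x0 ?c T)"
    using concave_on_combination[OF assms(1,3-5)] by (simp add: state_convex_combination[OF assms(5)])
  ultimately show ?thesis
    by (simp add: agent_payoff_def sum.distrib sum_distrib_left algebra_simps)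
qed

section \<open>Payments and social welfare\<close>

lemma agent_payoff_prices:
  "agent_payoff T A B f \<Phi> x0 p u e = agent_payoff T A B f \<Phi> x0 (\<lambda>_. 0) u e' + (\<Sum>t<T. p t * e t)"
  by (simp add: agent_payoff_def sum.distrib)

lemma social_welfare_eq_sum_payoffs:
  "social_welfare T A B f \<Phi> y0 U =
    (\<Sum>i\<in>UNIV. agent_payoff T (A i) (B i) (f i) (\<Phi> i) (y0 $ i) (\<lambda>_. 0) (U i) (E i))"
  by (simp add: social_welfare_def agent_payoff_def)

text \<open>All agents face the same price at each time, so total payments factor through the total
  trade, which is zero.\<close>

lemma sum_payoffs_market_clearing:
  assumes "market_clearing T E"
  shows "(\<Sum>i\<in>UNIV. agent_payoff T (A i) (B i) (f i) (\<Phi> i) (y0 $ i) p (U i) (E i)) =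
    social_welfare T A B f \<Phi> y0 U"
proof -
  have "(\<Sum>i\<in>UNIV. \<Sum>t<T. p t * E i t) = (\<Sum>t<T. p t * (\<Sum>i\<in>UNIV. E i t))"
    by (subst sum.swap) (simp add: sum_distrib_left)
  also have "\<dots> = 0" using assms by (simp add: market_clearing_def)
  finally have "(\<Sum>i\<in>UNIV. \<Sum>t<T. p t * E i t) = 0" .
  moreover have "agent_payoff T (A i) (B i) (f i) (\<Phi> i) (y0 $ i) p (U i) (E i) =
      agent_payoff T (A i) (B i) (f i) (\<Phi> i) (y0 $ i) (\<lambda>_. 0) (U i) (E i) + (\<Sum>t<T. p t * E i t)" for i
    by (rule agent_payoff_prices)
  ultimately show ?thesis
    by (simp add: sum.distrib social_welfare_eq_sum_payoffs[where E = E])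
qed

section \<open>Welfare optimality of competitive equilibria\<close>

lemma competitive_imp_social_welfare:
  assumes "competitive_equilibrium T A B f \<Phi> h a y0 p U E"
  shows "social_welfare_equilibrium T A B f \<Phi> h a y0 U E"
proof -
  have opt: "agent_payoff T (A i) (B i) (f i) (\<Phi> i) (y0 $ i) p u e
      \<le> agent_payoff T (A i) (B i) (f i) (\<Phi> i) (y0 $ i) p (U i) (E i)"
    if "trade_feasible T (h i) (a i) u e" for i u e
    using assms that by (force simp: competitive_equilibrium_def is_arg_max_linorder)
  have feas: "trade_feasible T (h i) (a i) (U i) (E i)" for i
    using assms by (force simp: competitive_equilibrium_def is_arg_max_linorder)
  have clear: "market_clearing T E" using assms by (simp add: competitive_equilibrium_def)
  have "social_welfare T A B f \<Phi> y0 U' \<le> social_welfare T A B f \<Phi> y0 U"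
    if "\<And>i. trade_feasible T (h i) (a i) (U' i) (E' i)" "market_clearing T E'" for U' E'
    \<comment> \<open>Both allocations clear the market, so both welfares become sums of payoffs at
      the same equilibrium prices and can be compared agent by agent.\<close>
    unfolding sum_payoffs_market_clearing[OF clear, where p = p and U = U, symmetric]
      sum_payoffs_market_clearing[OF that(2), where p = p and U = U', symmetric]
    using that(1) by (intro sum_mono opt)
  with feas clear show ?thesis
    by (auto simp: social_welfare_equilibrium_def is_arg_max_linorder)
qed

section \<open>Prices supporting a welfare optimum\<close>

text \<open>The trades of the witness share the excess supply equally.\<close>

lemma feasible_trades_exist:
  fixes U :: "'n::finite \<Rightarrow> nat \<Rightarrow> real ^ 'm"
  assumes "\<And>t. t < T \<Longrightarrow> (\<Sum>i\<in>UNIV. h i (U i t) - a i t) \<le> 0"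
  obtains E where "\<And>i. trade_feasible T (h i) (a i) (U i) (E i)" "market_clearing T E"
proof
  let ?g = "\<lambda>t. \<Sum>i\<in>UNIV. h i (U i t) - a i t"
  let ?E = "\<lambda>i t. a i t - h i (U i t) + ?g t / CARD('n)"
  show "trade_feasible T (h i) (a i) (U i) (?E i)" for i
    using assms by (simp add: trade_feasible_def divide_nonpos_pos)
  show "market_clearing T ?E"
    by (simp add: market_clearing_def sum.distrib sum_subtractf)
qed

lemma social_welfare_imp_competitive:
  fixes U :: "'n::finite \<Rightarrow> nat \<Rightarrow> real ^ 'm"
  assumes \<Phi>: "\<And>i. concave_on UNIV (\<Phi> i)"
    and f: "\<And>i. concave_on UNIV (\<lambda>(y, u). f i y u)"
    and h: "\<And>i. convex_on UNIV (h i)"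
    and slater: "\<And>t. t < T \<Longrightarrow> \<exists>z. (\<Sum>i\<in>UNIV. h i (z i) - a i t) < 0"
    and swe: "social_welfare_equilibrium T A B f \<Phi> h a y0 U E"
  shows "\<exists>p. competitive_equilibrium T A B f \<Phi> h a y0 p U E"
proof -
  define W where "W i u = agent_payoff T (A i) (B i) (f i) (\<Phi> i) (y0 $ i) (\<lambda>_. 0) u (\<lambda>_. 0)" for i u
  define F where "F U = (\<Sum>i\<in>UNIV. W i (U i))" for U
  \<comment> \<open>Aggregate excess demand at time \<open>t\<close>.\<close>
  define g where "g t U = (\<Sum>i\<in>UNIV. h i (U i t) - a i t)" for t and U :: "'n \<Rightarrow> nat \<Rightarrow> real ^ 'm"
  have F_eq: "social_welfare T A B f \<Phi> y0 U = F U" for U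
    unfolding F_def W_def by (rule social_welfare_eq_sum_payoffs)
  have feas: "E i t \<le> a i t - h i (U i t)" if "t < T" for i t
    using swe that by (auto simp: social_welfare_equilibrium_def is_arg_max_linorder trade_feasible_def)
  have clear: "market_clearing T E"
    using swe by (auto simp: social_welfare_equilibrium_def is_arg_max_linorder)
  \<comment> \<open>Trades do not enter the welfare, so any controls without excess demand compete
    with \<open>U\<close> once completed by feasible market-clearing trades.\<close>
  have opt: "F U' \<le> F U" if "\<And>t. t < T \<Longrightarrow> g t U' \<le> 0" for U'
  proof -
    obtain E' where "\<And>i. trade_feasible T (h i) (a i) (U' i) (E' i)" "market_clearing T E'"
      using feasible_trades_exist[of T h U' a] \<open>\<And>t. t < T \<Longrightarrow> g t U' \<le> 0\<close> unfolding g_def by blast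
    with swe show ?thesis
      by (auto simp: social_welfare_equilibrium_def is_arg_max_linorder F_eq)
  qed
  \<comment> \<open>Controls at different times are independent variables, so choices made time by
    time assemble into one Slater point for all constraints.\<close>
  obtain z where z: "\<And>t. t < T \<Longrightarrow> (\<Sum>i\<in>UNIV. h i (z t i) - a i t) < 0"
    using slater by metis
  have "\<exists>p. (\<forall>t<T. 0 \<le> p t) \<and> (\<forall>V\<in>UNIV. F V - (\<Sum>t<T. p t * g t V) \<le> F U)"
  proof (rule lagrange_multipliers)
    fix V V' :: "'n \<Rightarrow> nat \<Rightarrow> real ^ 'm" and r s :: real
    assume rs: "0 \<le> r" "0 \<le> s" "r + s = 1"
    let ?V = "\<lambda>i t. r *\<^sub>R V i t + s *\<^sub>R V' i t"
    have "r * F V + s * F V' \<le> F ?V"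
      unfolding F_def W_def sum_distrib_left sum.distrib[symmetric]
      by (intro sum_mono agent_utility_concave \<Phi> f rs)
    moreover have "g t ?V \<le> r * g t V + s * g t V'" for t
      unfolding g_def sum_distrib_left sum.distrib[symmetric]
    proof (rule sum_mono)
      fix i
      have "h i (?V i t) \<le> r * h i (V i t) + s * h i (V' i t)"
        using h[of i] rs by (auto simp: convex_on_def)
      moreover have "a i t = r * a i t + s * a i t" using rs by (simp flip: distrib_right)
      ultimately show "h i (?V i t) - a i t \<le> r * (h i (V i t) - a i t) + s * (h i (V' i t) - a i t)"
        by (simp add: right_diff_distrib)
    qed
    ultimately show "\<exists>V''\<in>UNIV. r * F V + s * F V' \<le> F V'' \<and>
        (\<forall>t<T. g t V'' \<le> r * g t V + s * g t V')" by blast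
  next
    show "g t (\<lambda>i t. z t i) < 0" if "t < T" for t using z that by (simp add: g_def)
  qed (use opt in auto)
  then obtain p where p: "\<And>t. t < T \<Longrightarrow> 0 \<le> p t" "\<And>V. F V - (\<Sum>t<T. p t * g t V) \<le> F U" by auto
  \<comment> \<open>\<open>L i u\<close> is the summand of agent \<open>i\<close> in the Lagrangian:
    the payoff at prices \<open>p\<close> when every trade is the largest allowed.\<close>
  define L where "L i u = W i u + (\<Sum>t<T. p t * (a i t - h i (u t)))" for i u
  define P where "P i = agent_payoff T (A i) (B i) (f i) (\<Phi> i) (y0 $ i) p" for i
  have P_le_L: "P i u e \<le> L i u" if "\<And>t. t < T \<Longrightarrow> e t \<le> a i t - h i (u t)" for i u e
    unfolding P_def L_def W_def agent_payoff_prices[where e' = "\<lambda>_. 0" and p = p]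
    using that p(1) by (intro add_left_mono sum_mono mult_left_mono) auto
  have sum_L: "(\<Sum>i\<in>UNIV. L i (V i)) = F V - (\<Sum>t<T. p t * g t V)" for V
  proof -
    have "(\<Sum>i\<in>UNIV. \<Sum>t<T. p t * (a i t - h i (V i t))) = - (\<Sum>t<T. p t * g t V)"
      by (subst sum.swap) (simp add: g_def sum_distrib_left algebra_simps flip: sum_negf)
    then show ?thesis by (simp add: L_def F_def sum.distrib)
  qed
  have sum_P: "(\<Sum>i\<in>UNIV. P i (U i) (E i)) = F U"
    unfolding P_def sum_payoffs_market_clearing[OF clear] by (rule F_eq)
  \<comment> \<open>Complementary slackness: the multiplier inequality at \<open>U\<close> bounds
    the sum of the \<open>L j (U j)\<close> by the sum of the payoffs, while each payoff is at most
    its \<open>L j (U j)\<close>; hence equality for every agent.\<close>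
  have slack: "P i (U i) (E i) = L i (U i)" for i
  proof -
    have "(\<Sum>i\<in>UNIV. L i (U i)) \<le> (\<Sum>i\<in>UNIV. P i (U i) (E i))"
      using p(2)[of U] by (simp add: sum_L sum_P)
    moreover have "P j (U j) (E j) \<le> L j (U j)" for j
      using feas by (rule P_le_L)
    ultimately show ?thesis
      using sum_mono_inv[of "\<lambda>i. P i (U i) (E i)" UNIV "\<lambda>i. L i (U i)" i]
      by (simp add: antisym sum_mono)
  qed
  have "L i u \<le> L i (U i)" for i u
  proof -
    \<comment> \<open>Only agent \<open>i\<close> deviates, so the other summands cancel in the
      multiplier inequality.\<close>
    have "(\<Sum>j\<in>UNIV. L j ((U(i := u)) j)) \<le> (\<Sum>j\<in>UNIV. L j (U j))"
      unfolding sum_L[of "U(i := u)"] slack[symmetric] sum_P by (rule p(2))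
    moreover have "(\<Sum>j\<in>UNIV - {i}. L j ((U(i := u)) j)) = (\<Sum>j\<in>UNIV - {i}. L j (U j))"
      by (rule sum.cong) auto
    ultimately show ?thesis by (simp add: sum.remove[of UNIV i])
  qed
  then have "P i u e \<le> P i (U i) (E i)" if "trade_feasible T (h i) (a i) u e" for i u e
    using P_le_L[of e i u] that slack by (auto simp: trade_feasible_def intro: order_trans)
  then have "competitive_equilibrium T A B f \<Phi> h a y0 p U E"
    using clear feas
    by (auto simp: competitive_equilibrium_def is_arg_max_linorder trade_feasible_def P_def)
  then show ?thesis by blast
qed

theorem theorem4:
  fixes T :: nat
    and A B :: "'n::finite \<Rightarrow> real ^ 'm ^ 'm"
    and f :: "'n \<Rightarrow> real ^ 'm \<Rightarrow> real ^ 'm \<Rightarrow> real"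
    and \<Phi> h :: "'n \<Rightarrow> real ^ 'm \<Rightarrow> real"
    and a :: "'n \<Rightarrow> nat \<Rightarrow> real"
    and y0 :: "real ^ 'm ^ 'n"
  assumes A1: "\<And>i. concave_on UNIV (\<Phi> i)"
    and A2: "\<And>i. concave_on UNIV (\<lambda>(y, u). f i y u)"
    and A3_nonneg: "\<And>i z. 0 \<le> h i z"
    and A3_convex: "\<And>i. convex_on UNIV (h i)"
    and A3_sublevels: "\<And>i. bounded_open_sublevels (h i)"
    and A4: "\<And>t. t < T \<Longrightarrow> 0 < (\<Sum>i\<in>UNIV. a i t)"
  shows "{(U, E). social_welfare_equilibrium T A B f \<Phi> h a y0 U E} =
           {(U, E). \<exists>p. competitive_equilibrium T A B f \<Phi> h a y0 p U E} \<and>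
         (\<forall>p U E. competitive_equilibrium T A B f \<Phi> h a y0 p U E
           \<longrightarrow> social_welfare_equilibrium T A B f \<Phi> h a y0 U E) \<and>
         (\<forall>U E. social_welfare_equilibrium T A B f \<Phi> h a y0 U E
           \<longrightarrow> (\<exists>p. competitive_equilibrium T A B f \<Phi> h a y0 p U E))"
proof -
  have "\<exists>z. (\<Sum>i\<in>UNIV. h i (z i) - a i t) < 0" if "t < T" for t
  proof -
    \<comment> \<open>An equal share of the total supply, positive by \<open>A4\<close>. Nonempty
      sublevel sets let every agent demand less than this share, so total demand is strictly below
      supply.\<close>
    let ?b = "(\<Sum>i\<in>UNIV. a i t) / CARD('n)"
    have "0 < ?b" using A4[OF that] by simp
    then have "\<exists>z. h i z < ?b" for i
      using A3_sublevels[of i] unfolding bounded_open_sublevels_def by blast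
    then obtain z where "\<And>i. h i (z i) < ?b" by metis
    then have "(\<Sum>i\<in>UNIV. h i (z i)) < (\<Sum>i\<in>(UNIV::'n set). ?b)"
      by (intro sum_strict_mono) auto
    then show ?thesis by (auto simp: sum_subtractf)
  qed
  then have "\<exists>p. competitive_equilibrium T A B f \<Phi> h a y0 p U E"
    if "social_welfare_equilibrium T A B f \<Phi> h a y0 U E" for U E
    using social_welfare_imp_competitive A1 A2 A3_convex that by blast
  then show ?thesis using competitive_imp_social_welfare by blast
qed

end
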